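(* Let $w$ be a reduced word in $d$ variables, $G$ a finite group, and $A$ a subgroup of $\operatorname{Aut}(G)$ containing $\operatorname{Inn}(G)$. Let $N$ be a characteristic subgroup of $G$. Denote by $\operatorname{ind}(A)$ the subgroup of $\operatorname{Aut}(G/N)$ consisting of all automorphisms of $G/N$ induced by some automorphism from $A$, by $\operatorname{res}(A)$ the subgroup of $\operatorname{Aut}(N)$ consisting of all restrictions of automorphisms from $A$ to $N$, and by $\pi:G\to G/N$ the canonical projection. Then: (1) For all $g\in G$, $\mathfrak{P}_w^{(A)}(G,g)\leq\mathfrak{P}_w^{(\operatorname{ind}(A))}(G/N,\pi(g))\cdot\mathfrak{P}_w^{(\operatorname{res}(A))}(N,1)$, or in terms of proportions, $\mathfrak{p}_w^{(A)}(G,g)\leq\mathfrak{p}_w^{(\operatorname{ind}(A))}(G/N,\pi(g))\cdot\mathfrak{p}_w^{(\operatorname{res}(A))}(N,1)$. (2) For all $g\in G$, $\mathfrak{P}_w^{(A)}(G,g)\leq\mathfrak{P}_w^{(A)}(G,1)$, or in terms of proportions, $\mathfrak{p}_w^{(A)}(G,g)\leq\mathfrak{p}_w^{(A)}(G,1)$. Hence $\mathfrak{P}_w^{(A)}(G,1)=\mathfrak{P}_w^{(A)}(G)$. (3) $\mathfrak{P}_w^{(A)}(G)\leq\mathfrak{P}_w^{(\operatorname{ind}(A))}(G/N)\cdot\mathfrak{P}_w^{(\operatorname{res}(A))}(N)$, or in terms of proportions, $\mathfrak{p}_w^{(A)}(G)\leq\mathfrak{p}_w^{(\operatorname{ind}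(A))}(G/N)\cdot\mathfrak{p}_w^{(\operatorname{res}(A))}(N)$.
   Context: A reduced word $w$ of length $l$ in the variables $X_1,\ldots,X_d$ is written as $w=x_1^{\epsilon_1}\cdots x_l^{\epsilon_l}$ with $x_i=X_{\iota(i)}$, $\iota:\{1,\ldots,l\}\to\{1,\ldots,d\}$, $\epsilon_i\in\{1,-1\}$ (an element of the free group on $X_1,\dots,X_d$ in reduced form). For a group $G$ and automorphisms $\alpha_1,\ldots,\alpha_l$ of $G$, the automorphic word map $w_G^{(\alpha_1,\ldots,\alpha_l)}:G^d\to G$ is $$(g_1,\ldots,g_d)\mapsto\alpha_1(g_{\iota(1)})^{\epsilon_1}\cdots\alpha_l(g_{\iota(l)})^{\epsilon_l}.$$ For a finite group $G$, a subset $A\subseteq\operatorname{Aut}(G)$ and $g\in G$: $\mathfrak{P}_w^{(A)}(G,g)$ is the maximum size of the fiber (preimage) of $g$ under an automorphic word map $w_G^{(\alpha_1,\ldots,\alpha_l)}$ with all $\alpha_i\in A$; $\mathfrak{P}_w^{(A)}(G):=\max_{g\in G}\mathfrak{P}_w^{(A)}(G,g)$; $\mathfrak{p}_w^{(A)}(G,g):=\mathfrak{P}_w^{(A)}(G,g)/|G|^d$; and $\mathfrak{p}_w^{(A)}(G):=\mathfrak{P}_w^{(A)}(G)/|G|^d$. $\operatorname{Inn}(G)$ is the group of inner automorphisms of $G$. *)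

theory Defs
  imports Complex_Main "HOL-Algebra.Algebra"
begin

section \<open>Reduced words and automorphic word maps\<close>

text \<open>The letter \<open>X\<^sub>i\<close> with exponent \<open>e\<close> is the pair \<open>(i, e)\<close>, with \<open>i \<in> {1..d}\<close> and
  \<open>e \<in> {1, -1}\<close>; in a reduced word no letter is followed by its inverse. The empty word is reduced.\<close>

type_synonym word = "(nat \<times> int) list"

definition reduced_word :: "nat \<Rightarrow> word \<Rightarrow> bool" where
  "reduced_word d w \<longleftrightarrow>
     set w \<subseteq> {1..d} \<times> {1, -1} \<and>
     (\<forall>k. Suc k < length w \<longrightarrow>
        \<not> (fst (w ! k) = fst (w ! Suc k) \<and> snd (w ! k) = - snd (w ! Suc k)))"

definition power_set :: "('a, 'b) monoid_scheme \<Rightarrow> nat \<Rightarrow> (nat \<Rightarrow> 'a) set" where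
  "power_set G d = {1..d} \<rightarrow>\<^sub>E carrier G"

definition aut_word_map ::
  "('a, 'b) monoid_scheme \<Rightarrow> word \<Rightarrow> ('a \<Rightarrow> 'a) list \<Rightarrow> (nat \<Rightarrow> 'a) \<Rightarrow> 'a" where
  "aut_word_map G w \<alpha>s g =
     foldr (\<otimes>\<^bsub>G\<^esub>) (map2 (\<lambda>\<alpha> (i, e). \<alpha> (g i) [^]\<^bsub>G\<^esub> e) \<alpha>s w) \<one>\<^bsub>G\<^esub>"

definition aut_word_fiber ::
  "nat \<Rightarrow> ('a, 'b) monoid_scheme \<Rightarrow> word \<Rightarrow> ('a \<Rightarrow> 'a) list \<Rightarrow> 'a \<Rightarrow> (nat \<Rightarrow> 'a) set" where
  "aut_word_fiber d G w \<alpha>s h = {g \<in> power_set G d. aut_word_map G w \<alpha>s g = h}"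

text \<open>For finite \<open>G\<close> and nonempty \<open>A\<close>, the maxima below are taken over finite nonempty sets.\<close>

definition P_at ::
  "nat \<Rightarrow> word \<Rightarrow> ('a \<Rightarrow> 'a) set \<Rightarrow> ('a, 'b) monoid_scheme \<Rightarrow> 'a \<Rightarrow> nat" where
  "P_at d w A G h =
     Max {card (aut_word_fiber d G w \<alpha>s h) | \<alpha>s. length \<alpha>s = length w \<and> set \<alpha>s \<subseteq> A}"

definition P_max ::
  "nat \<Rightarrow> word \<Rightarrow> ('a \<Rightarrow> 'a) set \<Rightarrow> ('a, 'b) monoid_scheme \<Rightarrow> nat" where
  "P_max d w A G = Max (P_at d w A G ` carrier G)"

definition p_at ::
  "nat \<Rightarrow> word \<Rightarrow> ('a \<Rightarrow> 'a) set \<Rightarrow> ('a, 'b) monoid_scheme \<Rightarrow> 'a \<Rightarrow> real" where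
  "p_at d w A G h = real (P_at d w A G h) / real (order G) ^ d"

definition p_max ::
  "nat \<Rightarrow> word \<Rightarrow> ('a \<Rightarrow> 'a) set \<Rightarrow> ('a, 'b) monoid_scheme \<Rightarrow> real" where
  "p_max d w A G = real (P_max d w A G) / real (order G) ^ d"


section \<open>Inner, restricted and induced automorphisms\<close>

text \<open>Elements of \<^const>\<open>auto\<close> are extensional functions, hence the restricted abstractions.\<close>

definition Inn :: "('a, 'b) monoid_scheme \<Rightarrow> ('a \<Rightarrow> 'a) set" where
  "Inn G = (\<lambda>a. \<lambda>x\<in>carrier G. a \<otimes>\<^bsub>G\<^esub> x \<otimes>\<^bsub>G\<^esub> inv\<^bsub>G\<^esub> a) ` carrier G"

definition characteristic_subgroup :: "'a set \<Rightarrow> ('a, 'b) monoid_scheme \<Rightarrow> bool" where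
  "characteristic_subgroup N G \<longleftrightarrow> subgroup N G \<and> (\<forall>\<alpha>\<in>auto G. \<alpha> ` N = N)"

definition res_auto :: "'a set \<Rightarrow> ('a \<Rightarrow> 'a) set \<Rightarrow> ('a \<Rightarrow> 'a) set" where
  "res_auto N A = (\<lambda>\<alpha>. restrict \<alpha> N) ` A"

definition ind_auto ::
  "('a, 'b) monoid_scheme \<Rightarrow> 'a set \<Rightarrow> ('a \<Rightarrow> 'a) set \<Rightarrow> ('a set \<Rightarrow> 'a set) set" where
  "ind_auto G N A =
     {\<beta> \<in> auto (G Mod N). \<exists>\<alpha>\<in>A. \<forall>x\<in>carrier G. \<beta> (N #>\<^bsub>G\<^esub> x) = N #>\<^bsub>G\<^esub> \<alpha> x}"


section \<open>Well-definedness\<close>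

lemma carrier_AutoGroup [simp]: "carrier (AutoGroup G) = auto G"
  by (simp add: AutoGroup_def)

lemma mult_AutoGroup:
  "\<alpha> \<in> auto G \<Longrightarrow> \<beta> \<in> auto G \<Longrightarrow> \<alpha> \<otimes>\<^bsub>AutoGroup G\<^esub> \<beta> = compose (carrier G) \<alpha> \<beta>"
  by (simp add: AutoGroup_def BijGroup_def auto_def)

lemma autoD:
  assumes "\<alpha> \<in> auto G"
  shows "\<alpha> \<in> hom G G" "\<alpha> \<in> extensional (carrier G)" "bij_betw \<alpha> (carrier G) (carrier G)"
    "\<And>x. x \<in> carrier G \<Longrightarrow> \<alpha> x \<in> carrier G"
  using assms by (auto simp: auto_def Bij_def bij_betw_def)

lemma autoI:
  "\<alpha> \<in> hom G G \<Longrightarrow> \<alpha> \<in> extensional (carrier G) \<Longrightarrow> bij_betw \<alpha> (carrier G) (carrier G) \<Longrightarrow> \<alpha> \<in> auto G"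
  by (auto simp: auto_def Bij_def)

lemma subgroup_hom_image:
  assumes "group K" "group L" "subgroup A K"
    and "\<And>x. x \<in> A \<Longrightarrow> h x \<in> carrier L"
    and "\<And>x y. x \<in> A \<Longrightarrow> y \<in> A \<Longrightarrow> h (x \<otimes>\<^bsub>K\<^esub> y) = h x \<otimes>\<^bsub>L\<^esub> h y"
  shows "subgroup (h ` A) L"
proof -
  have "group_hom (K\<lparr>carrier := A\<rparr>) L h"
    using assms by (auto simp: group_hom_def group_hom_axioms_def hom_def
        intro: subgroup.subgroup_is_group)
  from group_hom.img_is_subgroup[OF this] show ?thesis by simp
qed

context
  fixes G (structure) and N A
  assumes G: "group G" and A: "subgroup A (AutoGroup G)"
    and char: "characteristic_subgroup N G"
begin

interpretation group G by (rule G)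

lemma Inn_subset_auto: "Inn G \<subseteq> auto G"
proof
  fix \<alpha> assume "\<alpha> \<in> Inn G"
  then obtain a where a: "a \<in> carrier G" "\<alpha> = (\<lambda>x\<in>carrier G. a \<otimes> x \<otimes> inv a)"
    by (auto simp: Inn_def)
  have "\<alpha> \<in> hom G G"
    using a by (auto simp: hom_def m_assoc inv_solve_left)
  moreover have "inv a \<otimes> (a \<otimes> x) = x" "a \<otimes> (inv a \<otimes> x) = x" if "x \<in> carrier G" for x
    using a that by (simp_all flip: m_assoc)
  then have "bij_betw \<alpha> (carrier G) (carrier G)"
    by (intro bij_betw_byWitness[where f' = "\<lambda>x. inv a \<otimes> x \<otimes> a"])
      (use a in \<open>auto simp: m_assoc\<close>)
  ultimately show "\<alpha> \<in> auto G" using a by (auto intro: autoI)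
qed

lemma characteristic_normal: "N \<lhd> G"
proof -
  have N: "subgroup N G" using char by (simp add: characteristic_subgroup_def)
  have "a \<otimes> x \<otimes> inv a \<in> N" if "a \<in> carrier G" "x \<in> N" for a x
  proof -
    let ?c = "\<lambda>x\<in>carrier G. a \<otimes> x \<otimes> inv a"
    have "?c \<in> auto G" using that Inn_subset_auto by (auto simp: Inn_def)
    then have "?c ` N = N" using char unfolding characteristic_subgroup_def by blast
    moreover have "x \<in> carrier G" using that N subgroup.mem_carrier by fast
    ultimately show ?thesis using that(2) by force
  qed
  then show ?thesis using N normal_inv_iff by blast
qed

private lemma A_auto: "A \<subseteq> auto G"
  using subgroup.subset[OF A] by simp

private lemma A_image: "\<alpha> \<in> A \<Longrightarrow> \<alpha> ` N = N"
  using A_auto char unfolding characteristic_subgroup_def by blast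

private lemma N_carrier: "N \<subseteq> carrier G"
  using char by (simp add: characteristic_subgroup_def subgroup.subset)

lemma res_auto_subgroup: "subgroup (res_auto N A) (AutoGroup (G\<lparr>carrier := N\<rparr>))"
  unfolding res_auto_def
proof (rule subgroup_hom_image[OF AutoGroup _ A])
  have N: "subgroup N G" using char by (simp add: characteristic_subgroup_def)
  show "group (AutoGroup (G\<lparr>carrier := N\<rparr>))"
    using N by (intro group.AutoGroup subgroup.subgroup_is_group G)
  show *: "restrict \<alpha> N \<in> carrier (AutoGroup (G\<lparr>carrier := N\<rparr>))" if "\<alpha> \<in> A" for \<alpha>
  proof -
    have a: "\<alpha> \<in> auto G" using that A_auto by blast
    have "bij_betw (restrict \<alpha> N) N N"
      using autoD(3)[OF a] A_image[OF that] N_carrier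
      by (auto simp: bij_betw_def inj_on_restrict_eq intro: inj_on_subset)
    moreover have "restrict \<alpha> N \<in> hom (G\<lparr>carrier := N\<rparr>) (G\<lparr>carrier := N\<rparr>)"
      using autoD(1)[OF a] A_image[OF that] N_carrier subgroup.m_closed[OF N]
      by (auto simp: hom_def subset_iff)
    ultimately show ?thesis by (auto intro: autoI)
  qed
  show "restrict (\<alpha> \<otimes>\<^bsub>AutoGroup G\<^esub> \<beta>) N =
      restrict \<alpha> N \<otimes>\<^bsub>AutoGroup (G\<lparr>carrier := N\<rparr>)\<^esub> restrict \<beta> N" if "\<alpha> \<in> A" "\<beta> \<in> A" for \<alpha> \<beta>
  proof -
    have "\<alpha> \<in> auto G" "\<beta> \<in> auto G" using that A_auto by auto
    then show ?thesis
      using *[OF that(1)] *[OF that(2)] N_carrier A_image[OF that(2)]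
      by (auto simp: mult_AutoGroup compose_def fun_eq_iff subset_iff)
  qed
qed

private lemma image_rcoset:
  assumes "\<alpha> \<in> A" "x \<in> carrier G"
  shows "\<alpha> ` (N #> x) = N #> \<alpha> x"
proof -
  have "\<alpha> \<in> hom G G" using assms(1) A_auto autoD(1) by blast
  then have "\<alpha> (n \<otimes> x) = \<alpha> n \<otimes> \<alpha> x" if "n \<in> N" for n
    using that assms(2) N_carrier by (auto simp: hom_def)
  then have "\<alpha> ` (N #> x) = (\<lambda>n. n \<otimes> \<alpha> x) ` (\<alpha> ` N)"
    by (auto simp: r_coset_def image_iff)
  then show ?thesis using A_image[OF assms(1)] by (auto simp: r_coset_def)
qed

private lemma image_auto_Mod:
  assumes "\<alpha> \<in> A"
  shows "(\<lambda>C\<in>carrier (G Mod N). \<alpha> ` C) \<in> auto (G Mod N)"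
proof -
  interpret normal N G by (rule characteristic_normal)
  have a: "\<alpha> \<in> auto G" using assms A_auto by blast
  let ?b = "\<lambda>C\<in>carrier (G Mod N). \<alpha> ` C"
  have im: "?b ` carrier (G Mod N) = carrier (G Mod N)"
  proof -
    have "?b ` carrier (G Mod N) = (\<lambda>x. \<alpha> ` (N #> x)) ` carrier G"
      by (simp add: carrier_FactGroup image_image)
    also have "\<dots> = (\<lambda>x. N #> x) ` (\<alpha> ` carrier G)"
      by (simp add: image_rcoset[OF assms] image_image)
    also have "\<alpha> ` carrier G = carrier G" using autoD(3)[OF a] by (simp add: bij_betw_def)
    finally show ?thesis by (simp add: carrier_FactGroup)
  qed
  have sub: "C \<subseteq> carrier G" if "C \<in> carrier (G Mod N)" for C
    using that N_carrier by (auto simp: carrier_FactGroup r_coset_def)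
  have inj: "inj_on \<alpha> (carrier G)" using autoD(3)[OF a] by (simp add: bij_betw_def)
  have "inj_on ?b (carrier (G Mod N))"
  proof (rule inj_onI)
    fix C D assume "C \<in> carrier (G Mod N)" "D \<in> carrier (G Mod N)" "?b C = ?b D"
    then show "C = D" using inj_on_image_eq_iff[OF inj sub sub] by simp
  qed
  moreover have "?b \<in> hom (G Mod N) (G Mod N)"
  proof (rule homI)
    show "?b C \<in> carrier (G Mod N)" if "C \<in> carrier (G Mod N)" for C using im that by blast
    fix C D assume CD: "C \<in> carrier (G Mod N)" "D \<in> carrier (G Mod N)"
    then have "C \<otimes>\<^bsub>G Mod N\<^esub> D \<in> carrier (G Mod N)"
      by (meson factorgroup_is_group group.is_monoid monoid.m_closed)
    moreover from CD obtain x y where "x \<in> carrier G" "y \<in> carrier G" "C = N #> x" "D = N #> y"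
      by (auto simp: carrier_FactGroup)
    ultimately show "?b (C \<otimes>\<^bsub>G Mod N\<^esub> D) = ?b C \<otimes>\<^bsub>G Mod N\<^esub> ?b D"
      using CD autoD(1,4)[OF a] by (auto simp: rcos_sum image_rcoset[OF assms] hom_def)
  qed
  ultimately show ?thesis using im by (auto intro!: autoI simp: bij_betw_def)
qed

lemma ind_auto_eq: "ind_auto G N A = (\<lambda>\<alpha>. \<lambda>C\<in>carrier (G Mod N). \<alpha> ` C) ` A"
proof (intro equalityI subsetI)
  fix \<beta> assume "\<beta> \<in> ind_auto G N A"
  then obtain \<alpha> where b: "\<beta> \<in> auto (G Mod N)" and a: "\<alpha> \<in> A"
    and eq: "\<And>x. x \<in> carrier G \<Longrightarrow> \<beta> (N #> x) = N #> \<alpha> x"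
    by (auto simp: ind_auto_def)
  have "\<beta> C = \<alpha> ` C" if "C \<in> carrier (G Mod N)" for C
  proof -
    from that obtain x where "x \<in> carrier G" "C = N #> x" by (auto simp: carrier_FactGroup)
    then show ?thesis by (simp add: eq image_rcoset[OF a])
  qed
  then have "\<beta> = (\<lambda>C\<in>carrier (G Mod N). \<alpha> ` C)"
    by (intro extensionalityI[OF autoD(2)[OF b]]) auto
  then show "\<beta> \<in> (\<lambda>\<alpha>. \<lambda>C\<in>carrier (G Mod N). \<alpha> ` C) ` A" using a by blast
next
  fix \<beta> assume "\<beta> \<in> (\<lambda>\<alpha>. \<lambda>C\<in>carrier (G Mod N). \<alpha> ` C) ` A"
  then obtain \<alpha> where a: "\<alpha> \<in> A" and b: "\<beta> = (\<lambda>C\<in>carrier (G Mod N). \<alpha> ` C)" by blast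
  have "\<beta> (N #> x) = N #> \<alpha> x" if "x \<in> carrier G" for x
    using that by (simp add: b image_rcoset[OF a] carrier_FactGroup)
  then show "\<beta> \<in> ind_auto G N A"
    using image_auto_Mod[OF a] a unfolding ind_auto_def b by blast
qed

lemma ind_auto_subgroup: "subgroup (ind_auto G N A) (AutoGroup (G Mod N))"
  unfolding ind_auto_eq
proof (rule subgroup_hom_image[OF AutoGroup _ A])
  show "group (AutoGroup (G Mod N))"
    by (intro group.AutoGroup normal.factorgroup_is_group characteristic_normal)
  show *: "(\<lambda>C\<in>carrier (G Mod N). \<alpha> ` C) \<in> carrier (AutoGroup (G Mod N))" if "\<alpha> \<in> A" for \<alpha>
    using image_auto_Mod[OF that] by simp
  fix \<alpha> \<beta> assume ab: "\<alpha> \<in> A" "\<beta> \<in> A"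
  then have auto: "\<alpha> \<in> auto G" "\<beta> \<in> auto G" using A_auto by auto
  have "(compose (carrier G) \<alpha> \<beta>) ` C = \<alpha> ` (\<beta> ` C)" if "C \<in> carrier (G Mod N)" for C
  proof -
    have "C \<subseteq> carrier G" using that N_carrier by (auto simp: carrier_FactGroup r_coset_def)
    then show ?thesis by (auto simp: compose_def image_iff subset_iff)
  qed
  moreover have "\<beta> ` C \<in> carrier (G Mod N)" if "C \<in> carrier (G Mod N)" for C
    using that autoD(4)[OF auto(2)] by (auto simp: carrier_FactGroup image_rcoset[OF ab(2)])
  ultimately show "(\<lambda>C\<in>carrier (G Mod N). (\<alpha> \<otimes>\<^bsub>AutoGroup G\<^esub> \<beta>) ` C) =
      (\<lambda>C\<in>carrier (G Mod N). \<alpha> ` C) \<otimes>\<^bsub>AutoGroup (G Mod N)\<^esub> (\<lambda>C\<in>carrier (G Mod N). \<beta> ` C)"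
    using *[OF ab(1)] *[OF ab(2)] auto
    by (auto simp: mult_AutoGroup compose_def fun_eq_iff)
qed

end

end

theory Submission
  imports Defs
begin

text \<open>Write \<open>W\<^sub>\<alpha>\<close> for the automorphic word map given by \<open>\<alpha>\<^sub>1, \<dots>, \<alpha>\<^sub>l\<close>. For a fixed tuple \<open>r\<close>, moving
  every factor \<open>\<alpha>\<^sub>k(r\<^sub>i)\<close> to the right gives \<open>W\<^sub>\<alpha>(n r) = W\<^sub>\<beta>(n) W\<^sub>\<alpha>(r)\<close> for all tuples \<open>n\<close>, where each
  \<open>\<beta>\<^sub>k\<close> is \<open>\<alpha>\<^sub>k\<close> followed by an inner automorphism that depends only on \<open>r\<close>; so \<open>\<beta>\<^sub>k \<in> A\<close>. Hence right
  translation by any point of the fiber of \<open>W\<^sub>\<alpha>\<close> over \<open>g\<close> identifies this fiber with the fiber of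
  \<open>W\<^sub>\<beta>\<close> over \<open>1\<close>, and its points congruent to \<open>r\<close> modulo \<open>N\<close> with the part of the latter in \<open>N\<^sup>d\<close>.
  The congruence classes met by the fiber lie in a fiber over \<open>N g\<close> of an induced word map on
  \<open>G/N\<close>.\<close>

section \<open>Maximal fiber sizes\<close>

lemma aut_word_map_Nil [simp]: "aut_word_map G [] [] g = \<one>\<^bsub>G\<^esub>"
  by (simp add: aut_word_map_def)

lemma aut_word_map_Cons [simp]:
  "aut_word_map G ((i, e) # w) (\<alpha> # \<alpha>s) g =
     \<alpha> (g i) [^]\<^bsub>G\<^esub> e \<otimes>\<^bsub>G\<^esub> aut_word_map G w \<alpha>s g"
  by (simp add: aut_word_map_def)

lemma finite_aut_word_fiber:
  "finite (carrier G) \<Longrightarrow> finite (aut_word_fiber d G w \<alpha>s h)"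
  by (simp add: aut_word_fiber_def power_set_def finite_PiE)

text \<open>\<open>A\<close> is an arbitrary set of functions here and may be infinite, so
  finiteness comes from bounding the values: every fiber lies in the finite set
  \<open>power_set G d\<close>.\<close>

lemma finite_fiber_cards:
  assumes "finite (carrier G)"
  shows "finite {card (aut_word_fiber d G w \<alpha>s h) | \<alpha>s. length \<alpha>s = length w \<and> set \<alpha>s \<subseteq> A}"
proof (rule finite_subset)
  have "finite (power_set G d)"
    using assms by (simp add: power_set_def finite_PiE)
  then show "{card (aut_word_fiber d G w \<alpha>s h) | \<alpha>s. length \<alpha>s = length w \<and> set \<alpha>s \<subseteq> A}
      \<subseteq> {..card (power_set G d)}"
    by (auto simp: aut_word_fiber_def intro: card_mono)
qed simp

lemma card_fiber_le_P_at:
  assumes "finite (carrier G)" "length \<alpha>s = length w" "set \<alpha>s \<subseteq> A"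
  shows "card (aut_word_fiber d G w \<alpha>s h) \<le> P_at d w A G h"
  unfolding P_at_def using assms by (intro Max_ge finite_fiber_cards) auto

lemma P_at_leI:
  assumes "finite (carrier G)" "A \<noteq> {}"
    and "\<And>\<alpha>s. length \<alpha>s = length w \<Longrightarrow> set \<alpha>s \<subseteq> A \<Longrightarrow> card (aut_word_fiber d G w \<alpha>s h) \<le> k"
  shows "P_at d w A G h \<le> k"
proof -
  \<comment> \<open>The value of \<open>Max {}\<close> is unspecified; a constant list over
    \<open>A\<close> shows that the set of fiber sizes is nonempty.\<close>
  obtain \<alpha> where "\<alpha> \<in> A" using assms(2) by blast
  then have "length (replicate (length w) \<alpha>) = length w \<and> set (replicate (length w) \<alpha>) \<subseteq> A"
    by auto
  then have "{card (aut_word_fiber d G w \<alpha>s h) | \<alpha>s. length \<alpha>s = length w \<and> set \<alpha>s \<subseteq> A} \<noteq> {}"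
    by blast
  then show ?thesis
    unfolding P_at_def using assms(3) by (subst Max_le_iff[OF finite_fiber_cards[OF assms(1)]]) auto
qed

lemma P_at_le_P_max:
  "finite (carrier G) \<Longrightarrow> h \<in> carrier G \<Longrightarrow> P_at d w A G h \<le> P_max d w A G"
  unfolding P_max_def by (intro Max_ge) auto

text \<open>Partition \<open>F\<close> by the value of \<open>f\<close>. Below, \<open>f\<close> is
  reduction modulo \<open>N\<close> and \<open>k\<close> bounds the part of a fiber in one
  congruence class.\<close>

lemma card_le_card_image_mult:
  assumes "finite F" and "\<And>x. x \<in> F \<Longrightarrow> card {y \<in> F. f y = f x} \<le> k"
  shows "card F \<le> card (f ` F) * k"
proof -
  have "card F = card (\<Union>c\<in>f ` F. {y \<in> F. f y = c})"
    by (rule arg_cong[of _ _ card]) auto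
  also have "\<dots> \<le> (\<Sum>c\<in>f ` F. card {y \<in> F. f y = c})"
    using assms(1) by (intro card_UN_le) simp
  also have "\<dots> \<le> of_nat (card (f ` F)) * k"
    using assms(2) by (intro sum_bounded_above) auto
  finally show ?thesis by simp
qed

section \<open>Automorphic word maps, homomorphisms and translations\<close>

lemma (in group) aut_word_map_closed:
  assumes "length \<alpha>s = length w" "\<And>\<alpha> i. \<alpha> \<in> set \<alpha>s \<Longrightarrow> i \<in> fst ` set w \<Longrightarrow> \<alpha> (g i) \<in> carrier G"
  shows "aut_word_map G w \<alpha>s g \<in> carrier G"
  using assms
proof (induction \<alpha>s w rule: list_induct2)
  case (Cons \<alpha> \<alpha>s x w)
  then show ?case by (cases x) auto
qed simp

lemma aut_word_map_cong:
  assumes "length \<alpha>s = length w"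
    and "\<And>\<alpha> i. \<alpha> \<in> set \<alpha>s \<Longrightarrow> i \<in> fst ` set w \<Longrightarrow> \<phi> \<alpha> (g' i) = \<alpha> (g i)"
  shows "aut_word_map G w (map \<phi> \<alpha>s) g' = aut_word_map G w \<alpha>s g"
  using assms
proof (induction \<alpha>s w rule: list_induct2)
  case (Cons \<alpha> \<alpha>s x w)
  then show ?case by (cases x) auto
qed simp

text \<open>A homomorphism passes through products and integer powers, so compatibility at the
  letters suffices. The lemma serves three maps \<open>h\<close>: conjugation on \<open>G\<close>,
  projection to \<open>G Mod N\<close>, and inclusion of \<open>N\<close>.\<close>

lemma (in group_hom) hom_aut_word_map:
  assumes "length \<alpha>s = length w"
    and "\<And>\<alpha> i. \<alpha> \<in> set \<alpha>s \<Longrightarrow> i \<in> fst ` set w \<Longrightarrow> \<alpha> (g i) \<in> carrier G"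
    and "\<And>\<alpha> i. \<alpha> \<in> set \<alpha>s \<Longrightarrow> i \<in> fst ` set w \<Longrightarrow> \<phi> \<alpha> (g' i) = h (\<alpha> (g i))"
  shows "aut_word_map H w (map \<phi> \<alpha>s) g' = h (aut_word_map G w \<alpha>s g)"
  using assms
proof (induction \<alpha>s w rule: list_induct2)
  case (Cons \<alpha> \<alpha>s x w)
  obtain i e where "x = (i, e)" by (cases x)
  moreover have "aut_word_map G w \<alpha>s g \<in> carrier G"
    using Cons by (intro G.aut_word_map_closed) auto
  ultimately show ?case using Cons by (simp add: hom_int_pow)
qed simp

section \<open>Conjugation and right translation of tuples\<close>

lemma (in group) conjugation_group_hom:
  assumes "a \<in> carrier G"
  shows "group_hom G G (\<lambda>x. a \<otimes> x \<otimes> inv a)"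
proof -
  have "inv a \<otimes> (a \<otimes> x) = x" if "x \<in> carrier G" for x
    using assms that by (simp flip: m_assoc)
  then have "(\<lambda>x. a \<otimes> x \<otimes> inv a) \<in> hom G G"
    using assms by (auto simp: hom_def m_assoc)
  then show ?thesis by (simp add: group_hom_def group_hom_axioms_def)
qed

lemma AutoGroup_subgroupD:
  assumes "subgroup A (AutoGroup G)" "\<alpha> \<in> A"
  shows "\<alpha> \<in> auto G" "\<alpha> \<in> hom G G" "\<And>x. x \<in> carrier G \<Longrightarrow> \<alpha> x \<in> carrier G"
proof -
  show "\<alpha> \<in> auto G" using subgroup.subset[OF assms(1)] assms(2) by auto
  then show "\<alpha> \<in> hom G G" "\<And>x. x \<in> carrier G \<Longrightarrow> \<alpha> x \<in> carrier G"
    by (rule autoD)+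
qed

lemma (in group) conjugate_in_subgroup:
  assumes "subgroup A (AutoGroup G)" "Inn G \<subseteq> A" "a \<in> carrier G" "\<alpha> \<in> A"
  shows "(\<lambda>x\<in>carrier G. a \<otimes> \<alpha> x \<otimes> inv a) \<in> A"
proof -
  let ?c = "\<lambda>x\<in>carrier G. a \<otimes> x \<otimes> inv a"
  have c: "?c \<in> A" using assms(2,3) by (auto simp: Inn_def)
  note auto = AutoGroup_subgroupD[OF assms(1)]
  have "compose (carrier G) ?c \<alpha> \<in> A"
    using subgroup.m_closed[OF assms(1) c assms(4)]
    by (simp only: mult_AutoGroup[OF auto(1)[OF c] auto(1)[OF assms(4)]])
  moreover have "compose (carrier G) ?c \<alpha> = (\<lambda>x\<in>carrier G. a \<otimes> \<alpha> x \<otimes> inv a)"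
    using auto(3)[OF assms(4)] by (auto simp: compose_def fun_eq_iff)
  ultimately show ?thesis by simp
qed

text \<open>Induction on the word, moving the contribution of \<open>r\<close> in the first letter
  past the rest. The list \<open>\<beta>s\<close> is chosen before \<open>n\<close>, so one list
  serves all tuples; this lets a whole fiber be translated at once.\<close>

lemma (in group) aut_word_map_translate:
  assumes A: "subgroup A (AutoGroup G)" "Inn G \<subseteq> A"
    and len: "length \<alpha>s = length w" and "set \<alpha>s \<subseteq> A" "set w \<subseteq> I \<times> {1, -1}"
    and r: "\<And>i. i \<in> I \<Longrightarrow> r i \<in> carrier G"
  shows "\<exists>\<beta>s. length \<beta>s = length w \<and> set \<beta>s \<subseteq> A \<and>
    (\<forall>n. (\<forall>i\<in>I. n i \<in> carrier G) \<longrightarrow>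
      aut_word_map G w \<alpha>s (\<lambda>i. n i \<otimes> r i) = aut_word_map G w \<beta>s n \<otimes> aut_word_map G w \<alpha>s r)"
  using len assms(4,5)
proof (induction \<alpha>s w rule: list_induct2)
  case Nil
  then show ?case by simp
next
  case (Cons \<alpha> \<alpha>s x w)
  obtain i e where x: "x = (i, e)" by (cases x)
  have i: "i \<in> I" and e: "e = 1 \<or> e = -1" using Cons.prems x by auto
  note Acl = AutoGroup_subgroupD(3)[OF A(1)]
  have \<alpha>: "\<alpha> \<in> A" using Cons.prems by simp
  then have \<alpha>hom: "\<alpha> \<in> hom G G" by (rule AutoGroup_subgroupD(2)[OF A(1)])
  have subs: "set \<alpha>s \<subseteq> A" "set w \<subseteq> I \<times> {1, -1}" using Cons.prems by auto
  obtain \<beta>s where \<beta>s: "length \<beta>s = length w" "set \<beta>s \<subseteq> A"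
    and IH: "\<And>n. (\<forall>i\<in>I. n i \<in> carrier G) \<Longrightarrow>
      aut_word_map G w \<alpha>s (\<lambda>i. n i \<otimes> r i) = aut_word_map G w \<beta>s n \<otimes> aut_word_map G w \<alpha>s r"
    using Cons.IH[OF subs] by blast
  \<comment> \<open>\<open>v\<close> is the first factor of the word map at \<open>r\<close>. Moving
    it right past a factor \<open>B\<close> replaces \<open>B\<close> by \<open>v B v^-1\<close>,
    hence the conjugating map \<open>c\<close>.\<close>
  define v where "v = \<alpha> (r i) [^] e"
  define c where "c = (\<lambda>\<beta>. \<lambda>x\<in>carrier G. v \<otimes> \<beta> x \<otimes> inv v)"
  have v: "v \<in> carrier G" using Acl[OF \<alpha> r[OF i]] by (simp add: v_def)
  have c: "c \<beta> \<in> A" if "\<beta> \<in> A" for \<beta>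
    unfolding c_def using A v that by (rule conjugate_in_subgroup)
  \<comment> \<open>With \<open>a = \<alpha> (n i)\<close>, the first factor is \<open>a v\<close>
    if \<open>e = 1\<close>, where \<open>v\<close> already stands on the right. If
    \<open>e = -1\<close> it is \<open>v a^-1 = (v a v^-1)^-1 v\<close>, so the head has to be
    conjugated as well.\<close>
  define \<gamma>s where "\<gamma>s = (if e = 1 then \<alpha> else c \<alpha>) # map c \<beta>s"
  have sub: "fst ` set w \<subseteq> I" using Cons.prems by auto
  have "aut_word_map G (x # w) (\<alpha> # \<alpha>s) (\<lambda>i. n i \<otimes> r i) =
      aut_word_map G (x # w) \<gamma>s n \<otimes> aut_word_map G (x # w) (\<alpha> # \<alpha>s) r"
    if n: "\<forall>i\<in>I. n i \<in> carrier G" for n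
  proof -
    define a where "a = \<alpha> (n i)"
    define B where "B = aut_word_map G w \<beta>s n"
    define R where "R = aut_word_map G w \<alpha>s r"
    have a: "a \<in> carrier G" using Acl[OF \<alpha>] n i by (simp add: a_def)
    have \<beta>n: "\<beta> (n j) \<in> carrier G" if "\<beta> \<in> set \<beta>s" "j \<in> fst ` set w" for \<beta> j
    proof -
      have "\<beta> \<in> A" "n j \<in> carrier G" using that \<beta>s(2) n sub by auto
      then show ?thesis by (rule Acl)
    qed
    have \<alpha>r: "\<beta> (r j) \<in> carrier G" if "\<beta> \<in> set \<alpha>s" "j \<in> fst ` set w" for \<beta> j
    proof -
      have "\<beta> \<in> A" "r j \<in> carrier G" using that subs(1) r sub by auto
      then show ?thesis by (rule Acl)
    qed
    have B: "B \<in> carrier G" unfolding B_def using \<beta>s(1) \<beta>n by (rule aut_word_map_closed)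
    have R: "R \<in> carrier G" unfolding R_def using Cons.hyps \<alpha>r by (rule aut_word_map_closed)
    have cB: "aut_word_map G w (map c \<beta>s) n = v \<otimes> B \<otimes> inv v"
      unfolding B_def
    proof (rule group_hom.hom_aut_word_map[OF conjugation_group_hom[OF v] \<beta>s(1) \<beta>n])
      fix \<beta> j assume "j \<in> fst ` set w"
      then have "n j \<in> carrier G" using n sub by auto
      then show "c \<beta> (n j) = v \<otimes> \<beta> (n j) \<otimes> inv v" by (simp add: c_def)
    qed
    have mult: "\<alpha> (n i \<otimes> r i) = a \<otimes> \<alpha> (r i)"
      using \<alpha>hom n i r by (simp add: hom_def a_def)
    have cancel: "inv v \<otimes> (v \<otimes> y) = y" if "y \<in> carrier G" for y
      using v that by (simp flip: m_assoc)
    show ?thesis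
    proof (cases "e = 1")
      case True
      then have "v = \<alpha> (r i)" using Acl[OF \<alpha> r[OF i]] by (simp add: v_def)
      then show ?thesis
        using True a B R v cB cancel
        by (simp add: x \<gamma>s_def IH[OF n] mult m_assoc flip: B_def R_def a_def)
    next
      case False
      then have e: "e = -1" using e by simp
      then have vi: "v = inv (\<alpha> (r i))"
        using Acl[OF \<alpha> r[OF i]] by (simp add: v_def int_pow_neg)
      have "c \<alpha> (n i) = v \<otimes> a \<otimes> inv v" using n i by (simp add: c_def a_def)
      then have "aut_word_map G (x # w) \<gamma>s n = v \<otimes> inv a \<otimes> B \<otimes> inv v"
        using e a B v cB cancel
        by (simp add: x \<gamma>s_def int_pow_neg inv_mult_group m_assoc)
      moreover have "aut_word_map G (x # w) (\<alpha> # \<alpha>s) (\<lambda>i. n i \<otimes> r i) = v \<otimes> inv a \<otimes> (B \<otimes> R)"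
        using e a Acl[OF \<alpha> r[OF i]]
        by (simp add: x IH[OF n] mult int_pow_neg inv_mult_group vi flip: B_def R_def)
      moreover have "aut_word_map G (x # w) (\<alpha> # \<alpha>s) r = v \<otimes> R"
        by (simp add: x v_def R_def)
      ultimately show ?thesis using a B R v cancel by (simp add: m_assoc)
    qed
  qed
  moreover have "length \<gamma>s = length (x # w)" "set \<gamma>s \<subseteq> A"
    using \<beta>s c \<alpha> by (auto simp: \<gamma>s_def)
  ultimately show ?case by blast
qed

text \<open>Writing \<open>f = (f r^-1) r\<close> and applying the translation formula gives
  \<open>h = W(f r^-1) h\<close>, where \<open>W\<close> is the word map of \<open>\<beta>s\<close>;
  cancel \<open>h\<close>. The base point \<open>r\<close> alone determines the choice of
  \<open>\<beta>s\<close>.\<close>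

lemma (in group) translate_fiber:
  assumes A: "subgroup A (AutoGroup G)" "Inn G \<subseteq> A"
    and w: "set w \<subseteq> {1..d} \<times> {1, -1}"
    and \<alpha>s: "length \<alpha>s = length w" "set \<alpha>s \<subseteq> A"
    and h: "h \<in> carrier G" and r: "r \<in> aut_word_fiber d G w \<alpha>s h"
  shows "\<exists>\<beta>s. length \<beta>s = length w \<and> set \<beta>s \<subseteq> A \<and>
    (\<forall>f\<in>aut_word_fiber d G w \<alpha>s h.
      (\<lambda>i\<in>{1..d}. f i \<otimes> inv (r i)) \<in> aut_word_fiber d G w \<beta>s \<one>)"
proof -
  have car: "f i \<in> carrier G" if "f \<in> aut_word_fiber d G w \<alpha>s h" "i \<in> {1..d}" for f i
    using that by (auto simp: aut_word_fiber_def power_set_def)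
  obtain \<beta>s where \<beta>s: "length \<beta>s = length w" "set \<beta>s \<subseteq> A"
    and tr: "\<And>n. (\<forall>i\<in>{1..d}. n i \<in> carrier G) \<Longrightarrow>
      aut_word_map G w \<alpha>s (\<lambda>i. n i \<otimes> r i) = aut_word_map G w \<beta>s n \<otimes> aut_word_map G w \<alpha>s r"
    using aut_word_map_translate[OF A \<alpha>s w, of r] car[OF r] by blast
  note auto = AutoGroup_subgroupD[OF A(1)]
  have "(\<lambda>i\<in>{1..d}. f i \<otimes> inv (r i)) \<in> aut_word_fiber d G w \<beta>s \<one>"
    if f: "f \<in> aut_word_fiber d G w \<alpha>s h" for f
  proof -
    let ?n = "\<lambda>i\<in>{1..d}. f i \<otimes> inv (r i)"
    have n: "?n \<in> power_set G d" using car[OF f] car[OF r] by (auto simp: power_set_def)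
    then have ncar: "\<forall>i\<in>{1..d}. ?n i \<in> carrier G" by (auto simp: power_set_def)
    have fi: "?n i \<otimes> r i = f i" if "i \<in> {1..d}" for i
      using car[OF f that] car[OF r that] that by (simp add: m_assoc)
    \<comment> \<open>The two tuples are only known to agree on \<open>{1..d}\<close>, which
      contains every index in \<open>w\<close>; so word map values are compared instead of the
      tuples.\<close>
    have "aut_word_map G w (map id \<alpha>s) (\<lambda>i. ?n i \<otimes> r i) = aut_word_map G w \<alpha>s f"
    proof (rule aut_word_map_cong[OF \<alpha>s(1)])
      fix \<alpha> i assume "i \<in> fst ` set w"
      then have "i \<in> {1..d}" using w by auto
      then show "id \<alpha> (?n i \<otimes> r i) = \<alpha> (f i)" unfolding id_apply by (subst fi) simp_all
    qed
    moreover have "aut_word_map G w \<beta>s ?n \<in> carrier G"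
    proof (rule aut_word_map_closed[OF \<beta>s(1)])
      fix \<beta> i assume "\<beta> \<in> set \<beta>s" "i \<in> fst ` set w"
      then have "\<beta> \<in> A" "?n i \<in> carrier G" using \<beta>s(2) ncar w by auto
      then show "\<beta> (?n i) \<in> carrier G" by (rule auto(3))
    qed
    moreover have "aut_word_map G w \<alpha>s f = h" "aut_word_map G w \<alpha>s r = h"
      using f r by (simp_all add: aut_word_fiber_def)
    ultimately have "aut_word_map G w \<beta>s ?n = \<one>"
      using tr[OF ncar] h by (metis list.map_id r_cancel_one)
    then show ?thesis using n by (simp add: aut_word_fiber_def)
  qed
  then show ?thesis using \<beta>s by blast
qed

lemma (in group) inj_on_translate:
  assumes r: "r \<in> power_set G d"
  shows "inj_on (\<lambda>f. \<lambda>i\<in>{1..d}. f i \<otimes> inv (r i)) (power_set G d)"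
proof (rule inj_onI)
  fix f f' assume ff: "f \<in> power_set G d" "f' \<in> power_set G d"
    and eq: "(\<lambda>i\<in>{1..d}. f i \<otimes> inv (r i)) = (\<lambda>i\<in>{1..d}. f' i \<otimes> inv (r i))"
  have "f i = f' i" if i: "i \<in> {1..d}" for i
  proof -
    have "f i \<in> carrier G" "f' i \<in> carrier G" "r i \<in> carrier G"
      using ff r i by (auto simp: power_set_def)
    moreover have "f i \<otimes> inv (r i) = f' i \<otimes> inv (r i)"
      using fun_cong[OF eq, of i] i by simp
    ultimately show ?thesis by simp
  qed
  then show "f = f'"
    using ff unfolding power_set_def by (intro PiE_ext)
qed

text \<open>Translation by a point of the fiber over \<open>h\<close> embeds it in the fiber over
  \<open>\<one>\<close> of another word map with automorphisms from \<open>A\<close>.\<close>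

lemma (in group) P_at_le_P_at_one:
  assumes fin: "finite (carrier G)" and A: "subgroup A (AutoGroup G)" "Inn G \<subseteq> A"
    and w: "set w \<subseteq> {1..d} \<times> {1, -1}" and h: "h \<in> carrier G"
  shows "P_at d w A G h \<le> P_at d w A G \<one>"
proof (rule P_at_leI[OF fin])
  show "A \<noteq> {}" using subgroup.one_closed[OF A(1)] by blast
  fix \<alpha>s assume \<alpha>s: "length \<alpha>s = length w" "set \<alpha>s \<subseteq> A"
  let ?F = "aut_word_fiber d G w \<alpha>s h"
  show "card ?F \<le> P_at d w A G \<one>"
  \<comment> \<open>An empty fiber satisfies the bound trivially; in a nonempty one any point can be
    the base point.\<close>
  proof (cases "?F = {}")
    case False
    then obtain r where r: "r \<in> ?F" by blast
    let ?t = "\<lambda>f. \<lambda>i\<in>{1..d}. f i \<otimes> inv (r i)"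
    obtain \<beta>s where \<beta>s: "length \<beta>s = length w" "set \<beta>s \<subseteq> A"
      and t: "?t ` ?F \<subseteq> aut_word_fiber d G w \<beta>s \<one>"
      using translate_fiber[OF A w \<alpha>s h r] by blast
    have "inj_on ?t ?F"
      using r by (intro inj_on_subset[OF inj_on_translate]) (auto simp: aut_word_fiber_def)
    then have "card ?F \<le> card (aut_word_fiber d G w \<beta>s \<one>)"
      using t finite_aut_word_fiber[OF fin] by (rule card_inj_on_le)
    also have "\<dots> \<le> P_at d w A G \<one>"
      using fin \<beta>s by (rule card_fiber_le_P_at)
    finally show ?thesis .
  qed simp
qed

lemma (in group) rcos_eq_imp_mult_inv_mem:
  assumes "subgroup H G" "x \<in> carrier G" "y \<in> carrier G" "H #> x = H #> y"
  shows "x \<otimes> inv y \<in> H"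
proof -
  have "x \<in> H #> y" using assms rcos_self by blast
  then obtain n where "n \<in> H" "x = n \<otimes> y" by (auto simp: r_coset_def)
  then show ?thesis
    using assms subgroup.mem_carrier[OF assms(1)] by (simp add: m_assoc)
qed

section \<open>Passing to a characteristic subgroup and its quotient\<close>

text \<open>Count a fiber by congruence classes modulo \<open>N\<close>: at most \<open>?P\<close>
  classes meet it, and each contains at most \<open>?Q\<close> of its points.\<close>

lemma P_at_le_quotient_mult:
  fixes G (structure)
  assumes G: "group G" and fin: "finite (carrier G)"
    and A: "subgroup A (AutoGroup G)" "Inn G \<subseteq> A"
    and char: "characteristic_subgroup N G"
    and w: "set w \<subseteq> {1..d} \<times> {1, -1}" and h: "h \<in> carrier G"
  shows "P_at d w A G h \<le>
    P_at d w (ind_auto G N A) (G Mod N) (N #> h) * P_at d w (res_auto N A) (G\<lparr>carrier := N\<rparr>) \<one>"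
    (is "_ \<le> ?P * ?Q")
proof -
  interpret group G by (rule G)
  interpret normal N G using G A(1) char by (rule characteristic_normal)
  have sub: "subgroup N G" by (rule subgroup_axioms)
  have finN: "finite (carrier (G\<lparr>carrier := N\<rparr>))"
    using fin subset finite_subset by auto
  have finQ: "finite (carrier (G Mod N))"
    using fin by (simp add: carrier_FactGroup)
  note auto = AutoGroup_subgroupD[OF A(1)]
  have proj: "group_hom G (G Mod N) (\<lambda>x. N #> x)"
    using r_coset_hom_Mod factorgroup_is_group by (simp add: group_hom_def group_hom_axioms_def)
  have "\<exists>\<beta>\<in>ind_auto G N A. \<forall>x\<in>carrier G. \<beta> (N #> x) = N #> \<alpha> x" if "\<alpha> \<in> A" for \<alpha>
  proof -
    let ?\<beta> = "\<lambda>C\<in>carrier (G Mod N). \<alpha> ` C"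
    have \<beta>: "?\<beta> \<in> ind_auto G N A" using that ind_auto_eq[OF G A(1) char] by blast
    have hom: "\<alpha> \<in> hom G G" and N: "\<alpha> ` N = N"
      using auto(1,2)[OF that] char by (simp_all add: characteristic_subgroup_def)
    \<comment> \<open>Since \<open>\<alpha>\<close> maps \<open>N\<close> onto itself, it permutes
      the cosets of \<open>N\<close>.\<close>
    have "\<alpha> ` (N #> x) = N #> \<alpha> x" if x: "x \<in> carrier G" for x
    proof -
      have "\<alpha> ` (N #> x) = (\<lambda>n. \<alpha> n \<otimes> \<alpha> x) ` N"
        using hom x mem_carrier by (auto simp: r_coset_def hom_def image_iff)
      also have "\<dots> = (\<lambda>m. m \<otimes> \<alpha> x) ` (\<alpha> ` N)" by (simp add: image_image)
      finally show ?thesis using N by (auto simp: r_coset_def)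
    qed
    then show ?thesis using \<beta> by (intro bexI[of _ ?\<beta>]) (auto simp: carrier_FactGroup)
  qed
  \<comment> \<open>\<open>\<iota>\<close> fixes one induced automorphism for each member of
    \<open>A\<close>, so that lists over \<open>A\<close> can be mapped entry by entry.\<close>
  then obtain \<iota> where \<iota>: "\<And>\<alpha>. \<alpha> \<in> A \<Longrightarrow> \<iota> \<alpha> \<in> ind_auto G N A"
      "\<And>\<alpha> x. \<alpha> \<in> A \<Longrightarrow> x \<in> carrier G \<Longrightarrow> \<iota> \<alpha> (N #> x) = N #> \<alpha> x"
    by metis
  show ?thesis
  proof (rule P_at_leI[OF fin])
    show "A \<noteq> {}" using subgroup.one_closed[OF A(1)] by blast
    fix \<alpha>s assume \<alpha>s: "length \<alpha>s = length w" "set \<alpha>s \<subseteq> A"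
    define F where "F = aut_word_fiber d G w \<alpha>s h"
    \<comment> \<open>Componentwise reduction modulo \<open>N\<close>, cut off outside
      \<open>{1..d}\<close> so that it yields members of
      \<open>power_set (G Mod N) d\<close>.\<close>
    define \<pi> where "\<pi> = (\<lambda>f. \<lambda>i\<in>{1..d}. N #> (f i :: 'a))"
    have Fpow: "f \<in> power_set G d" if "f \<in> F" for f
      using that by (simp add: F_def aut_word_fiber_def)
    then have car: "f i \<in> carrier G" if "f \<in> F" "i \<in> {1..d}" for f i
      using that by (fastforce simp: power_set_def)
    have finF: "finite F" unfolding F_def using fin by (rule finite_aut_word_fiber)
    have "\<pi> ` F \<subseteq> aut_word_fiber d (G Mod N) w (map \<iota> \<alpha>s) (N #> h)"
    proof (rule image_subsetI)
      fix f assume f: "f \<in> F"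
      have pw: "\<pi> f \<in> power_set (G Mod N) d"
        using car[OF f] by (auto simp: power_set_def \<pi>_def carrier_FactGroup)
      have "aut_word_map (G Mod N) w (map \<iota> \<alpha>s) (\<pi> f) = N #> aut_word_map G w \<alpha>s f"
      proof (rule group_hom.hom_aut_word_map[OF proj \<alpha>s(1)])
        fix \<alpha> i assume "\<alpha> \<in> set \<alpha>s" "i \<in> fst ` set w"
        then have "\<alpha> \<in> A" and i: "i \<in> {1..d}" using \<alpha>s(2) w by auto
        then show "\<alpha> (f i) \<in> carrier G" "\<iota> \<alpha> (\<pi> f i) = N #> \<alpha> (f i)"
          using auto(3) \<iota>(2) car[OF f i] i by (simp_all add: \<pi>_def)
      qed
      then show "\<pi> f \<in> aut_word_fiber d (G Mod N) w (map \<iota> \<alpha>s) (N #> h)"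
        using pw f by (simp add: aut_word_fiber_def F_def)
    qed
    then have "card (\<pi> ` F) \<le> card (aut_word_fiber d (G Mod N) w (map \<iota> \<alpha>s) (N #> h))"
      using finite_aut_word_fiber[OF finQ] by (intro card_mono)
    also have "\<dots> \<le> ?P"
      using \<alpha>s \<iota>(1) by (intro card_fiber_le_P_at finQ) auto
    finally have P: "card (\<pi> ` F) \<le> ?P" .
    \<comment> \<open>Take \<open>r\<close> itself as base point: translation then sends its
      congruence class within \<open>F\<close> to tuples with all entries in
      \<open>N\<close>.\<close>
    have Q: "card {f \<in> F. \<pi> f = \<pi> r} \<le> ?Q" if r: "r \<in> F" for r
    proof -
      let ?t = "\<lambda>f. \<lambda>i\<in>{1..d}. f i \<otimes> inv (r i)"
      obtain \<beta>s where \<beta>s: "length \<beta>s = length w" "set \<beta>s \<subseteq> A"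
        and t: "\<And>f. f \<in> F \<Longrightarrow> ?t f \<in> aut_word_fiber d G w \<beta>s \<one>"
        using translate_fiber[OF A w \<alpha>s h] r unfolding F_def by blast
      let ?R = "map (\<lambda>\<beta>. restrict \<beta> N) \<beta>s"
      have "?t f \<in> aut_word_fiber d (G\<lparr>carrier := N\<rparr>) w ?R \<one>" if f: "f \<in> F" and "\<pi> f = \<pi> r" for f
      proof -
        have tN: "?t f i \<in> N" if i: "i \<in> {1..d}" for i
        proof -
          have "N #> f i = N #> r i" using fun_cong[OF \<open>\<pi> f = \<pi> r\<close>, of i] i by (simp add: \<pi>_def)
          then show ?thesis
            using rcos_eq_imp_mult_inv_mem[OF sub] car[OF f i] car[OF r i] i by simp
        qed
        then have "?t f \<in> power_set (G\<lparr>carrier := N\<rparr>) d" by (auto simp: power_set_def)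
        \<comment> \<open>The inclusion of \<open>N\<close> in \<open>G\<close> is a homomorphism,
          so the word map value computed in \<open>N\<close> equals the one computed in
          \<open>G\<close>.\<close>
        moreover have "aut_word_map G w (map id ?R) (?t f) = id (aut_word_map (G\<lparr>carrier := N\<rparr>) w ?R (?t f))"
        proof (rule group_hom.hom_aut_word_map[OF canonical_inj_is_hom[OF sub]])
          fix \<rho> i assume \<rho>: "\<rho> \<in> set ?R" "i \<in> fst ` set w"
          then obtain \<beta> where \<beta>: "\<beta> \<in> A" "\<rho> = restrict \<beta> N" using \<beta>s(2) by auto
          have "\<beta> ` N = N" using auto(1)[OF \<beta>(1)] char by (simp add: characteristic_subgroup_def)
          moreover have "?t f i \<in> N" using tN \<rho>(2) w by auto
          ultimately show "\<rho> (?t f i) \<in> carrier (G\<lparr>carrier := N\<rparr>)" using \<beta>(2) by auto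
        qed (simp_all add: \<beta>s(1))
        \<comment> \<open>On entries in \<open>N\<close> the restrictions agree with the
          \<open>\<beta>s\<close>, whose word map is already known to take the value
          \<open>\<one>\<close> here.\<close>
        moreover have "aut_word_map G w ?R (?t f) = aut_word_map G w \<beta>s (?t f)"
        proof (rule aut_word_map_cong[OF \<beta>s(1)])
          fix \<beta> i assume "i \<in> fst ` set w"
          then have "?t f i \<in> N" using tN w by auto
          then show "restrict \<beta> N (?t f i) = \<beta> (?t f i)" by (rule restrict_apply')
        qed
        ultimately show ?thesis using t[OF f] by (simp add: aut_word_fiber_def)
      qed
      then have "?t ` {f \<in> F. \<pi> f = \<pi> r} \<subseteq> aut_word_fiber d (G\<lparr>carrier := N\<rparr>) w ?R \<one>" by blast
      moreover have "inj_on ?t {f \<in> F. \<pi> f = \<pi> r}"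
        using Fpow r by (intro inj_on_subset[OF inj_on_translate]) auto
      ultimately have "card {f \<in> F. \<pi> f = \<pi> r} \<le> card (aut_word_fiber d (G\<lparr>carrier := N\<rparr>) w ?R \<one>)"
        using finite_aut_word_fiber[OF finN] by (intro card_inj_on_le)
      also have "\<dots> \<le> ?Q"
        using \<beta>s by (intro card_fiber_le_P_at finN) (auto simp: res_auto_def)
      finally show ?thesis .
    qed
    have "card F \<le> card (\<pi> ` F) * ?Q" using finF Q by (rule card_le_card_image_mult)
    also have "\<dots> \<le> ?P * ?Q" using P by simp
    finally show "card (aut_word_fiber d G w \<alpha>s h) \<le> ?P * ?Q" by (simp add: F_def)
  qed
qed

section \<open>Fiber sizes, proportions and maxima combined\<close>

theorem lemma2p1:
  fixes G :: "('a, 'b) monoid_scheme" and N :: "'a set" and A :: "('a \<Rightarrow> 'a) set"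
    and d :: nat and w :: word
  assumes "reduced_word d w"
    and "group G" and "finite (carrier G)"
    and "subgroup A (AutoGroup G)" and "Inn G \<subseteq> A"
    and "characteristic_subgroup N G"
  shows
    "(\<forall>g\<in>carrier G.
        P_at d w A G g \<le>
          P_at d w (ind_auto G N A) (G Mod N) (N #>\<^bsub>G\<^esub> g) *
          P_at d w (res_auto N A) (G\<lparr>carrier := N\<rparr>) \<one>\<^bsub>G\<lparr>carrier := N\<rparr>\<^esub> \<and>
        p_at d w A G g \<le>
          p_at d w (ind_auto G N A) (G Mod N) (N #>\<^bsub>G\<^esub> g) *
          p_at d w (res_auto N A) (G\<lparr>carrier := N\<rparr>) \<one>\<^bsub>G\<lparr>carrier := N\<rparr>\<^esub>) \<and>
     (\<forall>g\<in>carrier G.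
        P_at d w A G g \<le> P_at d w A G \<one>\<^bsub>G\<^esub> \<and>
        p_at d w A G g \<le> p_at d w A G \<one>\<^bsub>G\<^esub>) \<and>
     P_at d w A G \<one>\<^bsub>G\<^esub> = P_max d w A G \<and>
     P_max d w A G \<le>
       P_max d w (ind_auto G N A) (G Mod N) * P_max d w (res_auto N A) (G\<lparr>carrier := N\<rparr>) \<and>
     p_max d w A G \<le>
       p_max d w (ind_auto G N A) (G Mod N) * p_max d w (res_auto N A) (G\<lparr>carrier := N\<rparr>)"
proof -
  interpret group G by (rule assms(2))
  interpret normal N G using assms(2,4,6) by (rule characteristic_normal)
  note fin = assms(3)
  let ?N = "G\<lparr>carrier := N\<rparr>" and ?Q = "G Mod N"
  have w: "set w \<subseteq> {1..d} \<times> {1, -1}" using assms(1) by (simp add: reduced_word_def)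
  have finN: "finite (carrier ?N)" using fin subset finite_subset by auto
  have finQ: "finite (carrier ?Q)" using fin by (simp add: carrier_FactGroup)
  \<comment> \<open>By Lagrange the normalizing factor of \<open>G\<close> splits as that of the
    quotient times that of \<open>N\<close>; every product bound on sizes thus becomes one on
    proportions.\<close>
  have "order ?Q * order ?N = order G"
    using lagrange[OF subgroup_axioms] by (simp add: order_def FactGroup_def)
  then have ord: "real (order G) ^ d = real (order ?Q) ^ d * real (order ?N) ^ d"
    by (metis of_nat_mult power_mult_distrib)
  have ratio: "real a / real (order G) ^ d \<le> real b / real (order ?Q) ^ d * (real c / real (order ?N) ^ d)"
    if "a \<le> b * c" for a b c
  proof -
    have "real a \<le> real b * real c" using that by (metis of_nat_le_iff of_nat_mult)
    then show ?thesis unfolding ord by (simp add: divide_right_mono)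
  qed
  note quot = P_at_le_quotient_mult[OF assms(2-6) w]
  note one = P_at_le_P_at_one[OF assms(3-5) w]
  have max: "P_at d w A G \<one>\<^bsub>G\<^esub> = P_max d w A G"
  proof (rule antisym)
    show "P_at d w A G \<one>\<^bsub>G\<^esub> \<le> P_max d w A G" using fin by (rule P_at_le_P_max) simp
    show "P_max d w A G \<le> P_at d w A G \<one>\<^bsub>G\<^esub>"
      unfolding P_max_def using fin one by (intro Max.boundedI) auto
  qed
  \<comment> \<open>The maximum is attained at the identity, so the quotient bound at that single
    element suffices; each factor is then at most its own maximum.\<close>
  have "P_max d w A G \<le> P_at d w (ind_auto G N A) ?Q (N #>\<^bsub>G\<^esub> \<one>\<^bsub>G\<^esub>) * P_at d w (res_auto N A) ?N \<one>\<^bsub>G\<^esub>"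
    using quot[of "\<one>\<^bsub>G\<^esub>"] by (simp add: max)
  also have "\<dots> \<le> P_max d w (ind_auto G N A) ?Q * P_max d w (res_auto N A) ?N"
    using finQ finN by (intro mult_le_mono P_at_le_P_max) (auto simp: carrier_FactGroup)
  finally have max_le: "P_max d w A G \<le> P_max d w (ind_auto G N A) ?Q * P_max d w (res_auto N A) ?N" .
  show ?thesis
    using quot one max max_le ratio by (auto simp: p_at_def p_max_def divide_right_mono)
qed

end
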